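(* Let $(L;\wedge,\vee,^{\Delta},^{\nabla},0,1)$ be a weakly dicomplemented lattice and let $F(L)$ be the set of filters of $L$. For $F\in F(L)$ put $F^{\star}=\{a\in L\mid x^{\Delta}\le a\text{ for all } x\in F\}$. Then $(F(L);\cap,\vee,^{\star},\{1\},L)$ is a dual weakly complemented lattice, where $\vee$ denotes the join of filters (the smallest filter containing both). That is, $F^{\star}\in F(L)$ for every $F\in F(L)$, and for all $F,G\in F(L)$: $F\subseteq F^{\star\star}$; $F\subseteq G$ implies $G^{\star}\subseteq F^{\star}$; and $(F\vee G)\cap(F\vee G^{\star})=F$.
   Context: A weakly dicomplemented lattice (WDL) is an algebra $(L;\wedge,\vee,^{\Delta},^{\nabla},0,1)$ such that $(L;\wedge,\vee,0,1)$ is a bounded lattice and, for all $x,y\in L$: $x^{\Delta\Delta}\le x$; $x\le y\Rightarrow y^{\Delta}\le x^{\Delta}$; $(x\wedge y)\vee(x\wedge y^{\Delta})=x$; $x^{\nabla\nabla}\ge x$; $x\le y\Rightarrow y^{\nabla}\le x^{\nabla}$; $(x\vee y)\wedge(x\vee y^{\nabla})=x$. A dual weakly complemented lattice is a bounded lattice $(M;\wedge,\vee,0,1)$ with a unary operation $^{\nabla}$ satisfying the last three of these axioms. A filter of $L$ is a nonempty upward closed subset closed under $\wedge$; $F(L)$ is ordered by inclusion, with least element $\{1\}$ and greatest element $L$. *)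

theory Defs
  imports "HOL-Algebra.Lattice"
begin

locale weakly_complemented_lattice = bounded_lattice L for L (structure) +
  fixes wcompl :: "'a \<Rightarrow> 'a"
  assumes wcompl_closed: "x \<in> carrier L \<Longrightarrow> wcompl x \<in> carrier L"
    and wcompl_wcompl_le: "x \<in> carrier L \<Longrightarrow> wcompl (wcompl x) \<sqsubseteq> x"
    and wcompl_antimono:
      "\<lbrakk>x \<in> carrier L; y \<in> carrier L; x \<sqsubseteq> y\<rbrakk> \<Longrightarrow> wcompl y \<sqsubseteq> wcompl x"
    and meet_join_wcompl:
      "\<lbrakk>x \<in> carrier L; y \<in> carrier L\<rbrakk> \<Longrightarrow> (x \<sqinter> y) \<squnion> (x \<sqinter> wcompl y) = x"

locale dual_weakly_complemented_lattice = bounded_lattice L for L (structure) +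
  fixes dwcompl :: "'a \<Rightarrow> 'a"
  assumes dwcompl_closed: "x \<in> carrier L \<Longrightarrow> dwcompl x \<in> carrier L"
    and le_dwcompl_dwcompl: "x \<in> carrier L \<Longrightarrow> x \<sqsubseteq> dwcompl (dwcompl x)"
    and dwcompl_antimono:
      "\<lbrakk>x \<in> carrier L; y \<in> carrier L; x \<sqsubseteq> y\<rbrakk> \<Longrightarrow> dwcompl y \<sqsubseteq> dwcompl x"
    and join_meet_dwcompl:
      "\<lbrakk>x \<in> carrier L; y \<in> carrier L\<rbrakk> \<Longrightarrow> (x \<squnion> y) \<sqinter> (x \<squnion> dwcompl y) = x"

locale weakly_dicomplemented_lattice =
  weakly_complemented_lattice L wcompl + dual_weakly_complemented_lattice L dwcompl
  for L (structure) and wcompl and dwcompl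

definition lattice_filters :: "('a, 'b) gorder_scheme \<Rightarrow> 'a set set" where
  "lattice_filters L = {F. F \<subseteq> carrier L \<and> F \<noteq> {} \<and>
     (\<forall>x\<in>F. \<forall>y\<in>carrier L. x \<sqsubseteq>\<^bsub>L\<^esub> y \<longrightarrow> y \<in> F) \<and>
     (\<forall>x\<in>F. \<forall>y\<in>F. x \<sqinter>\<^bsub>L\<^esub> y \<in> F)}"

definition filter_order :: "('a, 'b) gorder_scheme \<Rightarrow> 'a set gorder" where
  "filter_order L = \<lparr>carrier = lattice_filters L, eq = (=), le = (\<subseteq>)\<rparr>"

definition filter_join :: "('a, 'b) gorder_scheme \<Rightarrow> 'a set \<Rightarrow> 'a set \<Rightarrow> 'a set" where
  "filter_join L F G = (LEAST H. H \<in> lattice_filters L \<and> F \<subseteq> H \<and> G \<subseteq> H)"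

definition filter_star :: "('a, 'b) gorder_scheme \<Rightarrow> ('a \<Rightarrow> 'a) \<Rightarrow> 'a set \<Rightarrow> 'a set" where
  "filter_star L wcompl F = {a \<in> carrier L. \<forall>x\<in>F. wcompl x \<sqsubseteq>\<^bsub>L\<^esub> a}"

end

theory Submission
  imports Defs
begin

text \<open>The join of two filters \<open>F\<close>, \<open>G\<close> is the up-closure of the meets \<open>f \<sqinter> g\<close>. If \<open>a\<close> lies above
  \<open>f\<^sub>1 \<sqinter> g\<close> and above \<open>f\<^sub>2 \<sqinter> h\<close> with \<open>g \<in> G\<close> and \<open>h\<close> in the star of \<open>G\<close>, then \<open>h\<close> lies above
  the weak complement \<open>g'\<close> of \<open>g\<close>. With \<open>f = f\<^sub>1 \<sqinter> f\<^sub>2\<close> the element \<open>a\<close> is therefore above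
  \<open>(f \<sqinter> g) \<squnion> (f \<sqinter> g') = f\<close>, hence in \<open>F\<close>.\<close>

section \<open>The inclusion order on filters and the closure properties of a filter\<close>

lemma carrier_filter_order [simp]: "carrier (filter_order L) = lattice_filters L"
  by (simp add: filter_order_def)

lemma le_filter_order [simp]: "F \<sqsubseteq>\<^bsub>filter_order L\<^esub> G \<longleftrightarrow> F \<subseteq> G"
  by (simp add: filter_order_def)

lemma partial_order_filter_order: "partial_order (filter_order L)"
  by unfold_locales (auto simp: filter_order_def)

lemma lattice_filtersI:
  assumes "F \<subseteq> carrier L" "F \<noteq> {}"
    and "\<And>x y. \<lbrakk>x \<in> F; y \<in> carrier L; x \<sqsubseteq>\<^bsub>L\<^esub> y\<rbrakk> \<Longrightarrow> y \<in> F"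
    and "\<And>x y. \<lbrakk>x \<in> F; y \<in> F\<rbrakk> \<Longrightarrow> x \<sqinter>\<^bsub>L\<^esub> y \<in> F"
  shows "F \<in> lattice_filters L"
  using assms by (auto simp: lattice_filters_def)

lemma lattice_filters_subset: "F \<in> lattice_filters L \<Longrightarrow> F \<subseteq> carrier L"
  by (simp add: lattice_filters_def)

lemma lattice_filters_up:
  "\<lbrakk>F \<in> lattice_filters L; x \<in> F; x \<sqsubseteq>\<^bsub>L\<^esub> y; y \<in> carrier L\<rbrakk> \<Longrightarrow> y \<in> F"
  by (auto simp: lattice_filters_def)

lemma lattice_filters_meet:
  "\<lbrakk>F \<in> lattice_filters L; x \<in> F; y \<in> F\<rbrakk> \<Longrightarrow> x \<sqinter>\<^bsub>L\<^esub> y \<in> F"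
  by (auto simp: lattice_filters_def)

section \<open>Filters of a bounded lattice: least, greatest, intersection\<close>

context bounded_lattice
begin

lemma meet_mono:
  assumes "x \<sqsubseteq> x'" "y \<sqsubseteq> y'"
    and "x \<in> carrier L" "x' \<in> carrier L" "y \<in> carrier L" "y' \<in> carrier L"
  shows "x \<sqinter> y \<sqsubseteq> x' \<sqinter> y'"
proof (rule meet_le)
  show "x \<sqinter> y \<sqsubseteq> x'"
    using le_trans[OF meet_left assms(1)] assms by simp
  show "x \<sqinter> y \<sqsubseteq> y'"
    using le_trans[OF meet_right assms(2)] assms by simp
qed (use assms in auto)

text \<open>A filter has some element, and \<open>\<top>\<close> lies above it. This shared element
  keeps intersections nonempty and serves as the neutral factor when a filter is embedded in a
  join.\<close>

lemma top_in_filter: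
  assumes "F \<in> lattice_filters L"
  shows "\<top> \<in> F"
proof -
  obtain x where "x \<in> F" using assms by (auto simp: lattice_filters_def)
  then show ?thesis
    using assms lattice_filters_up[of F L x \<top>] lattice_filters_subset[of F L] by auto
qed

lemma top_filter: "{\<top>} \<in> lattice_filters L"
proof (rule lattice_filtersI)
  show "y \<in> {\<top>}" if "x \<in> {\<top>}" "y \<in> carrier L" "x \<sqsubseteq> y" for x y
    using that by (auto intro: le_antisym)
  show "x \<sqinter> y \<in> {\<top>}" if "x \<in> {\<top>}" "y \<in> {\<top>}" for x y
    using that top_meet[of \<top>] by (simp add: eq_is_equal)
qed auto

lemma carrier_filter: "carrier L \<in> lattice_filters L"
  by (rule lattice_filtersI) auto

lemma filter_Int:
  assumes "F \<in> lattice_filters L" "G \<in> lattice_filters L"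
  shows "F \<inter> G \<in> lattice_filters L"
proof (rule lattice_filtersI)
  show "F \<inter> G \<subseteq> carrier L"
    using lattice_filters_subset[OF assms(1)] by blast
  show "F \<inter> G \<noteq> {}"
    using top_in_filter[OF assms(1)] top_in_filter[OF assms(2)] by blast
  show "y \<in> F \<inter> G" if "x \<in> F \<inter> G" "y \<in> carrier L" "x \<sqsubseteq> y" for x y
    using assms that by (blast intro: lattice_filters_up)
  show "x \<sqinter> y \<in> F \<inter> G" if "x \<in> F \<inter> G" "y \<in> F \<inter> G" for x y
    using assms that by (blast intro: lattice_filters_meet)
qed

section \<open>An elementwise description of the join of two filters\<close>

definition meets_up :: "'a set \<Rightarrow> 'a set \<Rightarrow> 'a set" where
  "meets_up F G = {a \<in> carrier L. \<exists>f\<in>F. \<exists>g\<in>G. f \<sqinter> g \<sqsubseteq> a}"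

lemma meets_upI: "\<lbrakk>f \<in> F; g \<in> G; f \<sqinter> g \<sqsubseteq> a; a \<in> carrier L\<rbrakk> \<Longrightarrow> a \<in> meets_up F G"
  by (auto simp: meets_up_def)

lemma meets_up_filter:
  assumes F: "F \<in> lattice_filters L" and G: "G \<in> lattice_filters L"
  shows "meets_up F G \<in> lattice_filters L"
proof (rule lattice_filtersI)
  note sub = lattice_filters_subset[OF F] lattice_filters_subset[OF G]
  show "meets_up F G \<subseteq> carrier L"
    by (auto simp: meets_up_def)
  have "\<top> \<sqinter> \<top> \<sqsubseteq> \<top>" by (simp add: meet_left)
  then have "\<top> \<in> meets_up F G"
    using top_in_filter[OF F] top_in_filter[OF G] by (intro meets_upI) auto
  then show "meets_up F G \<noteq> {}" by blast
  show "y \<in> meets_up F G" if x: "x \<in> meets_up F G" and y: "y \<in> carrier L" "x \<sqsubseteq> y" for x y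
  proof -
    obtain f g where fg: "x \<in> carrier L" "f \<in> F" "g \<in> G" "f \<sqinter> g \<sqsubseteq> x"
      using x by (auto simp: meets_up_def)
    moreover have "f \<sqinter> g \<sqsubseteq> y"
      using le_trans[OF fg(4) y(2)] fg sub y by (simp add: subset_iff)
    ultimately show ?thesis using y by (blast intro: meets_upI)
  qed
  show "x \<sqinter> y \<in> meets_up F G" if x: "x \<in> meets_up F G" and y: "y \<in> meets_up F G" for x y
  proof -
    obtain f g where fg: "x \<in> carrier L" "f \<in> F" "g \<in> G" "f \<sqinter> g \<sqsubseteq> x"
      using x by (auto simp: meets_up_def)
    obtain f' g' where fg': "y \<in> carrier L" "f' \<in> F" "g' \<in> G" "f' \<sqinter> g' \<sqsubseteq> y"
      using y by (auto simp: meets_up_def)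
    have c: "f \<in> carrier L" "g \<in> carrier L" "f' \<in> carrier L" "g' \<in> carrier L"
      using sub fg fg' by auto
    \<comment> \<open>The four factors are regrouped by the filter they come from, so that
      \<open>?m\<close> is again one element of \<open>F\<close> met with one element of
      \<open>G\<close>. This is why meets of pairs suffice in \<open>meets_up\<close>.\<close>
    let ?m = "(f \<sqinter> f') \<sqinter> (g \<sqinter> g')"
    have "?m \<sqsubseteq> f \<sqinter> g" "?m \<sqsubseteq> f' \<sqinter> g'"
      using c by (auto intro: meet_mono meet_left meet_right)
    then have "?m \<sqsubseteq> x" "?m \<sqsubseteq> y"
      using le_trans[OF _ fg(4)] le_trans[OF _ fg'(4)] fg(1) fg'(1) c by auto
    then have "?m \<sqsubseteq> x \<sqinter> y"
      using fg(1) fg'(1) c by (intro meet_le) auto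
    moreover have "f \<sqinter> f' \<in> F" "g \<sqinter> g' \<in> G"
      using F G fg fg' by (auto intro: lattice_filters_meet)
    ultimately show ?thesis
      using fg(1) fg'(1) by (intro meets_upI) auto
  qed
qed

text \<open>Each \<open>x\<close> lies above its meet with \<open>\<top>\<close>, and
  \<open>\<top>\<close> belongs to the other filter.\<close>

lemma meets_up_upper:
  assumes F: "F \<in> lattice_filters L" and G: "G \<in> lattice_filters L"
  shows "F \<subseteq> meets_up F G" "G \<subseteq> meets_up F G"
proof -
  note sub = lattice_filters_subset[OF F] lattice_filters_subset[OF G]
  show "F \<subseteq> meets_up F G"
  proof
    fix x assume "x \<in> F"
    then show "x \<in> meets_up F G"
      using sub top_in_filter[OF G] by (intro meets_upI[of x _ \<top>]) (auto intro: meet_left)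
  qed
  show "G \<subseteq> meets_up F G"
  proof
    fix x assume "x \<in> G"
    then show "x \<in> meets_up F G"
      using sub top_in_filter[OF F] by (intro meets_upI[of \<top> _ x]) (auto intro: meet_right)
  qed
qed

lemma meets_up_least:
  assumes "H \<in> lattice_filters L" "F \<subseteq> H" "G \<subseteq> H"
  shows "meets_up F G \<subseteq> H"
proof
  fix a assume "a \<in> meets_up F G"
  then obtain f g where "a \<in> carrier L" "f \<in> F" "g \<in> G" "f \<sqinter> g \<sqsubseteq> a"
    by (auto simp: meets_up_def)
  then show "a \<in> H"
    using assms lattice_filters_up[of H L "f \<sqinter> g" a] lattice_filters_meet[of H L f g] by auto
qed

text \<open>The three preceding lemmas say that \<open>meets_up F G\<close> is a filter, an upper
  bound and below every other such bound, which determines the \<open>LEAST\<close> value.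
  Membership in a join can then be unpacked into concrete elements \<open>f\<close> and
  \<open>g\<close>.\<close>

lemma filter_join_eq_meets_up:
  assumes "F \<in> lattice_filters L" "G \<in> lattice_filters L"
  shows "filter_join L F G = meets_up F G"
  unfolding filter_join_def
  using assms meets_up_filter meets_up_upper meets_up_least by (intro Least_equality) simp_all

section \<open>The bounded lattice of filters and its operations\<close>

lemma greatest_Lower_filters:
  assumes "F \<in> lattice_filters L" "G \<in> lattice_filters L"
  shows "greatest (filter_order L) (F \<inter> G) (Lower (filter_order L) {F, G})"
  using assms filter_Int by (intro greatest_LowerI) (auto simp: Lower_def)

lemma least_Upper_filters:
  assumes "F \<in> lattice_filters L" "G \<in> lattice_filters L"
  shows "least (filter_order L) (filter_join L F G) (Upper (filter_order L) {F, G})"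
  unfolding filter_join_eq_meets_up[OF assms]
proof (rule least_UpperI)
  show "meets_up F G \<sqsubseteq>\<^bsub>filter_order L\<^esub> H" if "H \<in> Upper (filter_order L) {F, G}" for H
    using that assms meets_up_least[of H F G] by (simp add: Upper_def)
qed (use assms meets_up_upper[OF assms] meets_up_filter in auto)

lemma least_top_filter: "least (filter_order L) {\<top>} (lattice_filters L)"
  using top_filter top_in_filter by (simp add: least_def)

lemma greatest_carrier_filter: "greatest (filter_order L) (carrier L) (lattice_filters L)"
  using carrier_filter lattice_filters_subset by (auto simp: greatest_def)

lemma bounded_lattice_filter_order: "bounded_lattice (filter_order L)"
proof -
  \<comment> \<open>With the order axioms in place, \<open>unfold_locales\<close> leaves only the
    existence of binary bounds and of the two extreme elements.\<close>
  interpret po: partial_order "filter_order L"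
    by (rule partial_order_filter_order)
  show ?thesis
  proof unfold_locales
    show "\<exists>H. least (filter_order L) H (Upper (filter_order L) {F, G})"
      if "F \<in> carrier (filter_order L)" "G \<in> carrier (filter_order L)" for F G
      using that least_Upper_filters by auto
    show "\<exists>H. greatest (filter_order L) H (Lower (filter_order L) {F, G})"
      if "F \<in> carrier (filter_order L)" "G \<in> carrier (filter_order L)" for F G
      using that greatest_Lower_filters by auto
    show "\<exists>H. least (filter_order L) H (carrier (filter_order L))"
      using least_top_filter by auto
    show "\<exists>H. greatest (filter_order L) H (carrier (filter_order L))"
      using greatest_carrier_filter by auto
  qed
qed

text \<open>The lattice meet is picked as some greatest lower bound. Such bounds are unique in a
  partial order, so exhibiting \<open>F \<inter> G\<close> as one identifies it. The join and the
  two extreme elements are identified by the same argument.\<close>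

lemma meet_filter_order:
  assumes "F \<in> lattice_filters L" "G \<in> lattice_filters L"
  shows "F \<sqinter>\<^bsub>filter_order L\<^esub> G = F \<inter> G"
proof -
  interpret fl: bounded_lattice "filter_order L"
    by (rule bounded_lattice_filter_order)
  show ?thesis
    using fl.greatest_unique[OF fl.inf_of_two_greatest greatest_Lower_filters] assms
    by (simp add: meet_def)
qed

lemma join_filter_order:
  assumes "F \<in> lattice_filters L" "G \<in> lattice_filters L"
  shows "F \<squnion>\<^bsub>filter_order L\<^esub> G = filter_join L F G"
proof -
  interpret fl: bounded_lattice "filter_order L"
    by (rule bounded_lattice_filter_order)
  show ?thesis
    using fl.least_unique[OF fl.sup_of_two_least least_Upper_filters] assms
    by (simp add: join_def)
qed

lemma bottom_filter_order: "\<bottom>\<^bsub>filter_order L\<^esub> = {\<top>}"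
proof -
  interpret fl: bounded_lattice "filter_order L"
    by (rule bounded_lattice_filter_order)
  show ?thesis
    using fl.least_unique[OF fl.bottom_least] least_top_filter by simp
qed

lemma top_filter_order: "\<top>\<^bsub>filter_order L\<^esub> = carrier L"
proof -
  interpret fl: bounded_lattice "filter_order L"
    by (rule bounded_lattice_filter_order)
  show ?thesis
    using fl.greatest_unique[OF fl.top_greatest] greatest_carrier_filter by simp
qed

end

section \<open>The star operation and the dual weak complementation axioms\<close>

lemma filter_star_antimono: "F \<subseteq> G \<Longrightarrow> filter_star L c G \<subseteq> filter_star L c F"
  by (auto simp: filter_star_def)

context weakly_complemented_lattice
begin

text \<open>The star is the set of upper bounds of the image of \<open>F\<close> under
  \<open>wcompl\<close>. Any set of upper bounds contains \<open>\<top>\<close>, is upward closed,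
  and contains the meet of any two of its members.\<close>

lemma filter_star_filter:
  assumes "F \<subseteq> carrier L"
  shows "filter_star L wcompl F \<in> lattice_filters L"
proof (rule lattice_filtersI)
  have "\<top> \<in> filter_star L wcompl F"
    using assms wcompl_closed by (auto simp: filter_star_def)
  then show "filter_star L wcompl F \<noteq> {}" by blast
  show "y \<in> filter_star L wcompl F"
    if x: "x \<in> filter_star L wcompl F" and y: "y \<in> carrier L" "x \<sqsubseteq> y" for x y
  proof -
    have "wcompl z \<sqsubseteq> y" if z: "z \<in> F" for z
    proof (rule le_trans)
      show "wcompl z \<sqsubseteq> x" "x \<in> carrier L"
        using z x by (auto simp: filter_star_def)
      show "wcompl z \<in> carrier L"
        using z assms wcompl_closed by auto
    qed (use y in simp_all)
    then show ?thesis using y by (simp add: filter_star_def)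
  qed
  show "x \<sqinter> y \<in> filter_star L wcompl F"
    if "x \<in> filter_star L wcompl F" "y \<in> filter_star L wcompl F" for x y
    using that subsetD[OF assms] by (simp add: filter_star_def meet_le wcompl_closed)
qed (auto simp: filter_star_def)

text \<open>For \<open>a\<close> in \<open>F\<close> and \<open>x\<close> in the star,
  \<open>wcompl a \<sqsubseteq> x\<close>. Antitonicity turns this into
  \<open>wcompl x \<sqsubseteq> wcompl (wcompl a)\<close>, and the latter is below
  \<open>a\<close>.\<close>

lemma subset_filter_star_filter_star:
  assumes "F \<subseteq> carrier L"
  shows "F \<subseteq> filter_star L wcompl (filter_star L wcompl F)"
proof
  fix a assume a: "a \<in> F"
  have "wcompl x \<sqsubseteq> a" if "x \<in> filter_star L wcompl F" for x
  proof -
    have x: "x \<in> carrier L" "wcompl a \<sqsubseteq> x"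
      using that a by (auto simp: filter_star_def)
    have ac: "a \<in> carrier L" using a assms by auto
    have "wcompl x \<sqsubseteq> wcompl (wcompl a)"
      using x ac by (intro wcompl_antimono wcompl_closed)
    then show ?thesis
      using le_trans[OF _ wcompl_wcompl_le[OF ac]] x ac wcompl_closed by simp
  qed
  then show "a \<in> filter_star L wcompl (filter_star L wcompl F)"
    using a assms by (auto simp: filter_star_def)
qed

lemma filter_join_Int_filter_join_star:
  assumes F: "F \<in> lattice_filters L" and G: "G \<in> lattice_filters L"
  shows "filter_join L F G \<inter> filter_join L F (filter_star L wcompl G) = F"
proof -
  let ?S = "filter_star L wcompl G"
  note sub = lattice_filters_subset[OF F] lattice_filters_subset[OF G]
  have S: "?S \<in> lattice_filters L" using sub by (intro filter_star_filter)
  have "a \<in> F" if a: "a \<in> meets_up F G" "a \<in> meets_up F ?S" for a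
  proof -
    obtain f1 g where 1: "a \<in> carrier L" "f1 \<in> F" "g \<in> G" "f1 \<sqinter> g \<sqsubseteq> a"
      using a by (auto simp: meets_up_def)
    obtain f2 h where 2: "f2 \<in> F" "h \<in> ?S" "f2 \<sqinter> h \<sqsubseteq> a"
      using a by (auto simp: meets_up_def)
    have h: "h \<in> carrier L" "wcompl g \<sqsubseteq> h"
      using 1 2 by (auto simp: filter_star_def)
    let ?f = "f1 \<sqinter> f2"
    have fF: "?f \<in> F" using F 1 2 by (intro lattice_filters_meet)
    have c: "f1 \<in> carrier L" "f2 \<in> carrier L" "g \<in> carrier L" "wcompl g \<in> carrier L"
      using 1 2 sub wcompl_closed by auto
    have "?f \<sqinter> g \<sqsubseteq> f1 \<sqinter> g" "?f \<sqinter> wcompl g \<sqsubseteq> f2 \<sqinter> h"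
      using c h by (auto intro: meet_mono meet_left meet_right)
    then have "?f \<sqinter> g \<sqsubseteq> a" "?f \<sqinter> wcompl g \<sqsubseteq> a"
      using le_trans[OF _ 1(4)] le_trans[OF _ 2(3)] 1(1) c h by auto
    then have "(?f \<sqinter> g) \<squnion> (?f \<sqinter> wcompl g) \<sqsubseteq> a"
      using c 1 by (intro join_le) auto
    \<comment> \<open>Here the axiom \<open>meet_join_wcompl\<close> enters: it collapses the join
      on the left to \<open>?f\<close>.\<close>
    then have "?f \<sqsubseteq> a"
      using c by (simp add: meet_join_wcompl)
    then show "a \<in> F"
      using F fF 1 by (blast intro: lattice_filters_up)
  qed
  \<comment> \<open>The easy inclusion: \<open>F\<close> lies in each of its joins, the second being
    a join of filters by \<open>S\<close>.\<close>
  moreover have "F \<subseteq> meets_up F G \<inter> meets_up F ?S"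
    using F G S meets_up_upper by auto
  ultimately show ?thesis
    using F G S by (auto simp: filter_join_eq_meets_up)
qed

lemma dual_weakly_complemented_lattice_filter_order:
  "dual_weakly_complemented_lattice (filter_order L) (filter_star L wcompl)"
proof -
  \<comment> \<open>This settles the lattice part, so that only the closure of the star and the
    three complementation axioms remain.\<close>
  interpret fl: bounded_lattice "filter_order L"
    by (rule bounded_lattice_filter_order)
  have star: "filter_star L wcompl F \<in> lattice_filters L" if "F \<in> lattice_filters L" for F
    using that by (intro filter_star_filter lattice_filters_subset)
  show ?thesis
  proof unfold_locales
    fix F G
    assume "F \<in> carrier (filter_order L)" "G \<in> carrier (filter_order L)"
    then have F: "F \<in> lattice_filters L" and G: "G \<in> lattice_filters L" by simp_all
    show "filter_star L wcompl F \<in> carrier (filter_order L)"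
      using star[OF F] by simp
    show "F \<sqsubseteq>\<^bsub>filter_order L\<^esub> filter_star L wcompl (filter_star L wcompl F)"
      using subset_filter_star_filter_star[OF lattice_filters_subset[OF F]] by simp
    show "filter_star L wcompl G \<sqsubseteq>\<^bsub>filter_order L\<^esub> filter_star L wcompl F"
      if "F \<sqsubseteq>\<^bsub>filter_order L\<^esub> G"
      using that by (simp add: filter_star_antimono)
    \<comment> \<open>The outer meet may be rewritten to an intersection only once both joins are
      known to be filters.\<close>
    have "filter_join L F G \<in> lattice_filters L"
      "filter_join L F (filter_star L wcompl G) \<in> lattice_filters L"
      using F G star by (simp_all add: filter_join_eq_meets_up meets_up_filter)
    then show "(F \<squnion>\<^bsub>filter_order L\<^esub> G) \<sqinter>\<^bsub>filter_order L\<^esub>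
        (F \<squnion>\<^bsub>filter_order L\<^esub> filter_star L wcompl G) = F"
      using F G star
      by (simp add: join_filter_order meet_filter_order filter_join_Int_filter_join_star)
  qed
qed

end

theorem theorem3p3:
  fixes L :: "('a, 'b) gorder_scheme" and wcompl dwcompl :: "'a \<Rightarrow> 'a"
  assumes "weakly_dicomplemented_lattice L wcompl dwcompl"
  shows "dual_weakly_complemented_lattice (filter_order L) (filter_star L wcompl) \<and>
    \<bottom>\<^bsub>filter_order L\<^esub> = {\<top>\<^bsub>L\<^esub>} \<and>
    \<top>\<^bsub>filter_order L\<^esub> = carrier L \<and>
    (\<forall>F\<in>lattice_filters L. \<forall>G\<in>lattice_filters L.
       F \<sqinter>\<^bsub>filter_order L\<^esub> G = F \<inter> G \<and>
       F \<squnion>\<^bsub>filter_order L\<^esub> G = filter_join L F G) \<and>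
    (\<forall>F\<in>lattice_filters L. filter_star L wcompl F \<in> lattice_filters L) \<and>
    (\<forall>F\<in>lattice_filters L. \<forall>G\<in>lattice_filters L.
       F \<subseteq> filter_star L wcompl (filter_star L wcompl F) \<and>
       (F \<subseteq> G \<longrightarrow> filter_star L wcompl G \<subseteq> filter_star L wcompl F) \<and>
       filter_join L F G \<inter> filter_join L F (filter_star L wcompl G) = F)"
proof -
  interpret weakly_complemented_lattice L wcompl
    using assms by (rule weakly_dicomplemented_lattice.axioms(1))
  show ?thesis
    by (intro conjI ballI impI dual_weakly_complemented_lattice_filter_order
        bottom_filter_order top_filter_order meet_filter_order join_filter_order
        filter_star_filter subset_filter_star_filter_star filter_star_antimono
        filter_join_Int_filter_join_star lattice_filters_subset)
qed

end
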